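(* Let $k$ be an algebraically closed field of characteristic $0$, $C=\mathbb{P}^1_k$ and $K=k(t)$. Let $a,b,b'\in k$ with $a,b,b'\neq 0,1$ and $ab'+b/a=0$. For each positive integer $N$, let $\varphi$ be the degree $2$ morphism $\mathbb{P}^1_K\to\mathbb{P}^1_K$ given by $$\varphi=\frac{X^2+\lambda_1XY}{\lambda_2XY+Y^2},\qquad \lambda_1=a+bt^N,\quad \lambda_2=a^{-1}+b't^N .$$ Then the degree of the conductor of $\varphi$ is at most $2$, and the degree of the minimal resultant of $\varphi$ is at least $2N$.
   Context: For a closed point $p\in C$, $v_p$ is the normalized valuation of $\mathcal{O}_{C,p}$. A presentation of a degree $d$ morphism $\varphi:\mathbb{P}^1_K\to\mathbb{P}^1_K$ (coordinates $[X,Y]$) is the point $\Phi=[\mathbf{a},\mathbf{b}]=[a_0,\dots,a_d,b_0,\dots,b_d]\in\mathbb{P}^{2d+1}(K)$ of coefficients of forms $F_{\mathbf a}=\sum a_iX^{d-i}Y^i$, $F_{\mathbf b}=\sum b_iX^{d-i}Y^i$ without common zero over $\bar K$ with $\varphi=[F_{\mathbf a}:F_{\mathbf b}]$. $\rho(\mathbf a,\mathbf b)$ is the resultant of $F_{\mathbf a},F_{\mathbf b}$ as forms of degree $d$ ($2d\times2d$ Sylvester determinant). For $\Gamma=\begin{pmatrix}\alpha&\beta\\ \gamma&\delta\end{pmatrix}\in\mathrm{GL}_2(K)$, $(\mathbf a^\Gamma,\mathbf b^\Gamma)$ are the coefficients of $\begin{pmatrix}\delta&-\beta\\-\gamma&\alpha\end{pmatrix}\big(F_{\mathbf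 a}(\alpha X+\beta Y,\gamma X+\delta Y),F_{\mathbf b}(\alpha X+\beta Y,\gamma X+\delta Y)\big)^T$, and $\Phi^\Gamma=[\mathbf a^\Gamma,\mathbf b^\Gamma]$ (conjugation action of $\mathrm{PGL}_2(K)$). $n_p(\mathbf a,\mathbf b)$ is the minimum of $v_p$ over all coordinates, $N_{\Phi,p}=v_p(\rho(\mathbf a,\mathbf b))-2d\,n_p(\mathbf a,\mathbf b)$ (independent of the affine representative). The minimal resultant is $R_\varphi=\sum_{p}\min_{\Gamma\in \mathrm{PGL}_2(K)}N_{\Phi^\Gamma,p}\,[p]$ and the conductor is $\mathfrak{f}_\varphi=\sum_{p\in\mathrm{Supp}(R_\varphi)}[p]$, both divisors on $C=\mathbb{P}^1_k$. *)

theory Defs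
  imports
    "HOL-Computational_Algebra.Computational_Algebra"
    "HOL-Algebra.Algebraic_Closure_Type"
    "Jordan_Normal_Form.Determinant"
    "Subresultants.Resultant_Prelim"
begin

section \<open>The curve \<open>C = \<P>\<^sup>1\<^sub>k\<close>, its function field, and divisors\<close>

text \<open>
  For an algebraically closed field \<open>k\<close> the closed points of \<open>\<P>\<^sup>1\<^sub>k\<close> are the elements of \<open>k\<close>
  together with the point at infinity, all of them of degree one.  The function field
  \<open>K = k(t)\<close> is the type \<^typ>\<open>'k poly fract\<close>.
\<close>

datatype 'k pline = Finite 'k | Infinity

fun poly_val :: "'k::field pline \<Rightarrow> 'k poly \<Rightarrow> int" where
  "poly_val (Finite c) f = int (Polynomial.order c f)"
| "poly_val Infinity f = - int (Polynomial.degree f)"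

lemma poly_val_mult:
  "f \<noteq> 0 \<Longrightarrow> g \<noteq> 0 \<Longrightarrow> poly_val p (f * g) = poly_val p f + poly_val p g"
  by (cases p) (simp_all add: order_mult Polynomial.degree_mult_eq)

text \<open>
  The normalized valuation of \<open>\<O>\<^bsub>C,p\<^esub>\<close>.  Its value at \<open>0\<close> should be \<open>+\<infinity>\<close>; here it is the
  dummy value \<open>0\<close>, so minima of valuations below are taken over nonzero elements only.
\<close>

definition val :: "'k::field pline \<Rightarrow> 'k poly fract \<Rightarrow> int" where
  "val p x = (if x = 0 then 0 else
     (THE v. \<exists>f g. f \<noteq> 0 \<and> g \<noteq> 0 \<and> x = Fraction_Field.Fract f g \<and>
        v = poly_val p f - poly_val p g))"

lemma val_Fract:
  assumes "f \<noteq> 0" "g \<noteq> 0"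
  shows "val p (Fraction_Field.Fract f g) = poly_val p f - poly_val p g"
proof -
  let ?P = "\<lambda>v. \<exists>f' g'. f' \<noteq> 0 \<and> g' \<noteq> 0 \<and>
    Fraction_Field.Fract f g = Fraction_Field.Fract f' g' \<and> v = poly_val p f' - poly_val p g'"
  have "Fraction_Field.Fract f g \<noteq> Fraction_Field.Fract 0 1"
    using assms by (subst eq_fract(1)) auto
  then have nz: "Fraction_Field.Fract f g \<noteq> 0"
    unfolding Zero_fract_def .
  have "(THE v. ?P v) = poly_val p f - poly_val p g"
  proof (rule the_equality)
    show "?P (poly_val p f - poly_val p g)" using assms by blast
  next
    fix v assume "?P v"
    then obtain f' g' where *: "f' \<noteq> 0" "g' \<noteq> 0"
      "Fraction_Field.Fract f g = Fraction_Field.Fract f' g'" "v = poly_val p f' - poly_val p g'"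
      by blast
    have "f * g' = f' * g"
      using *(3) eq_fract(1)[OF assms(2) *(2)] by (simp only:)
    then have "poly_val p f + poly_val p g' = poly_val p f' + poly_val p g"
      by (metis poly_val_mult assms *(1,2))
    then show "v = poly_val p f - poly_val p g" using *(4) by linarith
  qed
  then show ?thesis unfolding val_def using nz by (simp only: if_False)
qed

definition kconst :: "'k::field \<Rightarrow> 'k poly fract" where
  "kconst c = Fraction_Field.Fract [:c:] 1"

definition tvar :: "'k::field poly fract" where
  "tvar = Fraction_Field.Fract [:0, 1:] 1"

text \<open>A divisor is a finitely supported integer-valued function on the closed points.\<close>

definition Supp :: "('k pline \<Rightarrow> int) \<Rightarrow> 'k pline set" where
  "Supp D = {p. D p \<noteq> 0}"

definition is_divisor :: "('k pline \<Rightarrow> int) \<Rightarrow> bool" where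
  "is_divisor D \<longleftrightarrow> finite (Supp D)"

definition divisor_degree :: "('k pline \<Rightarrow> int) \<Rightarrow> int" where
  "divisor_degree D = (\<Sum>p\<in>Supp D. D p)"

section \<open>Binary forms and presentations\<close>

text \<open>
  A form \<open>a\<^sub>0 X\<^sup>d + a\<^sub>1 X\<^sup>d\<^sup>-\<^sup>1 Y + \<dots> + a\<^sub>d Y\<^sup>d\<close> is given by its vector of \<open>d + 1\<close> coefficients.
  It can be evaluated in any commutative ring, in particular in the polynomial ring \<open>K[Y][X]\<close>.
\<close>

definition form :: "nat \<Rightarrow> 'a::comm_ring_1 vec \<Rightarrow> 'a \<Rightarrow> 'a \<Rightarrow> 'a" where
  "form d a x y = (\<Sum>i\<le>d. a $ i * x ^ (d - i) * y ^ i)"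

text \<open>
  \<open>(a, b)\<close> is a representative of a presentation of a morphism of degree \<open>d\<close>: the two forms have
  no common zero over the algebraic closure.
\<close>

definition is_presentation :: "nat \<Rightarrow> 'a::field vec \<Rightarrow> 'a vec \<Rightarrow> bool" where
  "is_presentation d a b \<longleftrightarrow>
     a \<in> carrier_vec (d + 1) \<and> b \<in> carrier_vec (d + 1) \<and>
     \<not> (\<exists>x y. (x, y) \<noteq> (0, 0) \<and>
          form d (map_vec to_ac a) x y = 0 \<and> form d (map_vec to_ac b) x y = 0)"

text \<open>
  The resultant of two forms of degree \<open>d\<close>: the \<open>2d \<times> 2d\<close> Sylvester determinant for the formal
  degrees \<open>d, d\<close>, whatever the actual degrees of the dehomogenized forms \<open>F(X, 1)\<close> are.
\<close>

definition dehom :: "nat \<Rightarrow> 'a::comm_ring_1 vec \<Rightarrow> 'a poly" where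
  "dehom d a = (\<Sum>i\<le>d. Polynomial.monom (a $ i) (d - i))"

definition form_resultant :: "nat \<Rightarrow> 'a::comm_ring_1 vec \<Rightarrow> 'a vec \<Rightarrow> 'a" where
  "form_resultant d a b = Determinant.det (sylvester_mat_sub d d (dehom d a) (dehom d b))"

section \<open>The conjugation action\<close>

text \<open>
  In \<^typ>\<open>'a poly poly\<close> the outer variable is \<open>X\<close> and the inner one is \<open>Y\<close>.
\<close>

definition cst :: "'a::comm_ring_1 \<Rightarrow> 'a poly poly" where
  "cst c = [:[:c:]:]"

definition varX :: "'a::comm_ring_1 poly poly" where
  "varX = [:0, 1:]"

definition varY :: "'a::comm_ring_1 poly poly" where
  "varY = [:[:0, 1:]:]"

definition form_coeffs :: "nat \<Rightarrow> 'a::comm_ring_1 poly poly \<Rightarrow> 'a vec" where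
  "form_coeffs d F = vec (d + 1) (\<lambda>i. Polynomial.coeff (Polynomial.coeff F (d - i)) i)"

definition GL2 :: "'a::field mat set" where
  "GL2 = {\<Gamma> \<in> carrier_mat 2 2. invertible_mat \<Gamma>}"

definition form_subst :: "nat \<Rightarrow> 'a::comm_ring_1 mat \<Rightarrow> 'a vec \<Rightarrow> 'a poly poly" where
  "form_subst d \<Gamma> a =
     form d (map_vec cst a)
       (cst (\<Gamma> $$ (0,0)) * varX + cst (\<Gamma> $$ (0,1)) * varY)
       (cst (\<Gamma> $$ (1,0)) * varX + cst (\<Gamma> $$ (1,1)) * varY)"

definition conj_fst :: "nat \<Rightarrow> 'a::comm_ring_1 mat \<Rightarrow> 'a vec \<Rightarrow> 'a vec \<Rightarrow> 'a vec" where
  "conj_fst d \<Gamma> a b = form_coeffs d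
     (cst (\<Gamma> $$ (1,1)) * form_subst d \<Gamma> a - cst (\<Gamma> $$ (0,1)) * form_subst d \<Gamma> b)"

definition conj_snd :: "nat \<Rightarrow> 'a::comm_ring_1 mat \<Rightarrow> 'a vec \<Rightarrow> 'a vec \<Rightarrow> 'a vec" where
  "conj_snd d \<Gamma> a b = form_coeffs d
     (cst (\<Gamma> $$ (0,0)) * form_subst d \<Gamma> b - cst (\<Gamma> $$ (1,0)) * form_subst d \<Gamma> a)"

section \<open>Minimal resultant and conductor\<close>

definition coord_min_val ::
  "'k::field pline \<Rightarrow> 'k poly fract vec \<Rightarrow> 'k poly fract vec \<Rightarrow> int" where
  "coord_min_val p a b = Min (val p ` ((set\<^sub>v a \<union> set\<^sub>v b) - {0}))"

definition res_val ::
  "nat \<Rightarrow> 'k::field pline \<Rightarrow> 'k poly fract vec \<Rightarrow> 'k poly fract vec \<Rightarrow> int" where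
  "res_val d p a b = val p (form_resultant d a b) - 2 * int d * coord_min_val p a b"

text \<open>
  The value of \<^const>\<open>res_val\<close> depends only on the point \<open>[a, b]\<close> and is unchanged when \<open>\<Gamma>\<close> is
  scaled, so the minimum over \<open>PGL\<^sub>2(K)\<close> is taken over matrices in \<open>GL\<^sub>2(K)\<close>.
\<close>

definition min_resultant ::
  "nat \<Rightarrow> 'k::field poly fract vec \<Rightarrow> 'k poly fract vec \<Rightarrow> 'k pline \<Rightarrow> int" where
  "min_resultant d a b p =
     (LEAST m. \<exists>\<Gamma>\<in>GL2. m = res_val d p (conj_fst d \<Gamma> a b) (conj_snd d \<Gamma> a b))"

definition conductor ::
  "nat \<Rightarrow> 'k::field poly fract vec \<Rightarrow> 'k poly fract vec \<Rightarrow> 'k pline \<Rightarrow> int" where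
  "conductor d a b p = (if p \<in> Supp (min_resultant d a b) then 1 else 0)"

end

(*
  Under conjugation by \<Gamma> the resultant of a quadratic map and the discriminant of its fixed-point
  form Y F_a - X F_b are both multiplied by det(\<Gamma>)^6, and both are homogeneous of degree 4 in the
  coefficients. The discriminant bounds 4 n_p of every conjugate by 6 v_p(det \<Gamma>) + v_p(disc), so
  the minimal resultant at p is at least v_p(res) - v_p(disc); homogeneity of the resultant shows that
  it is never negative. For the given map res = 1 - \<lambda>1 \<lambda>2 = - b b' t^(2N), while disc is a
  square, namely ((1 - \<lambda>2) (\<lambda>1 - 1))^2, which is a unit at t = 0 because a \<noteq> 1.
  Hence the minimal resultant is at least 2N at t = 0, and at finite t \<noteq> 0 the map itself
  already has good reduction, which leaves only 0 and infinity in the support.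
*)
theory Submission
  imports Defs
begin

no_notation fps_nth (infixl "$" 75)

section \<open>Resultant and fixed-point form under conjugation\<close>

text \<open>Laplace expansion along the first row, with each minor again of the form
  \<open>mat n n\<close>, so that the equation rewrites down to \<open>det_mat_0\<close>.\<close>

lemma det_mat_Suc:
  fixes f :: "nat \<times> nat \<Rightarrow> 'a::comm_ring_1"
  shows "Determinant.det (mat (Suc n) (Suc n) f) =
    (\<Sum>j<Suc n. f (0, j) * ((-1) ^ j *
      Determinant.det (mat n n (\<lambda>(i, k). f (Suc i, if k < j then k else Suc k)))))"
proof -
  let ?M = "mat (Suc n) (Suc n) f"
  have "mat_delete ?M 0 j = mat n n (\<lambda>(i, k). f (Suc i, if k < j then k else Suc k))" if "j < Suc n" for j
    using that by (intro eq_matI) (auto simp: mat_delete_def)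
  then show ?thesis
    by (subst laplace_expansion_row[of _ "Suc n" 0]) (auto simp: Determinant.cofactor_def intro!: sum.cong)
qed

lemma det_mat_0: "Determinant.det (mat 0 0 f) = (1 :: 'a::comm_ring_1)"
  by (rule det_dim_zero) simp

lemma coeff_dehom: "Polynomial.coeff (dehom d a) k = (if k \<le> d then a $ (d - k) else 0)"
proof -
  have "Polynomial.coeff (dehom d a) k = (\<Sum>i\<le>d. if k \<le> d \<and> i = d - k then a $ i else 0)"
    unfolding dehom_def coeff_sum by (rule sum.cong) auto
  then show ?thesis by simp
qed

text \<open>The 4 by 4 Sylvester determinant depends only on the 2 by 2 minors of the coefficient
  matrix, whose behaviour under conjugation is easy to follow.\<close>

lemma form_resultant_2:
  "form_resultant 2 a b =
    (a $ 0 * b $ 2 - a $ 2 * b $ 0)\<^sup>2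
    - (a $ 0 * b $ 1 - a $ 1 * b $ 0) * (a $ 1 * b $ 2 - a $ 2 * b $ 1)"
proof -
  have four: "(2::nat) + 2 = Suc (Suc (Suc (Suc 0)))" by simp
  show ?thesis
    unfolding form_resultant_def sylvester_mat_sub_def four
    by (simp add: det_mat_Suc det_mat_0 coeff_dehom lessThan_Suc numeral_2_eq_2 numeral_3_eq_3)
      (simp add: algebra_simps)
qed

section \<open>Coefficients of a conjugated pair of quadratic forms\<close>

lemma form_2: "form 2 a x y = a $ 0 * x\<^sup>2 + a $ 1 * x * y + a $ 2 * y\<^sup>2"
  by (simp add: form_def numeral_2_eq_2)

text \<open>The coefficient of X^(2-i) Y^i in F(\<alpha> X + \<beta> Y, \<gamma> X + \<delta> Y),
  where F has coefficient vector \<open>a\<close>.\<close>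

definition subst_coeffs :: "'a::comm_ring_1 mat \<Rightarrow> 'a vec \<Rightarrow> nat \<Rightarrow> 'a" where
  "subst_coeffs G a i = (let \<alpha> = G $$ (0,0); \<beta> = G $$ (0,1); \<gamma> = G $$ (1,0); \<delta> = G $$ (1,1) in
     if i = 0 then a $ 0 * \<alpha>\<^sup>2 + a $ 1 * \<alpha> * \<gamma> + a $ 2 * \<gamma>\<^sup>2
     else if i = 1 then 2 * a $ 0 * \<alpha> * \<beta> + a $ 1 * (\<alpha> * \<delta> + \<beta> * \<gamma>) + 2 * a $ 2 * \<gamma> * \<delta>
     else a $ 0 * \<beta>\<^sup>2 + a $ 1 * \<beta> * \<delta> + a $ 2 * \<delta>\<^sup>2)"

lemma form_subst_2:
  assumes "a \<in> carrier_vec 3"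
  shows "form_subst 2 G a =
    [: [:0, 0, subst_coeffs G a 2:], [:0, subst_coeffs G a 1:], [:subst_coeffs G a 0:] :]"
  using assms unfolding form_subst_def form_2
  by (simp add: cst_def varX_def varY_def subst_coeffs_def Let_def power2_eq_square algebra_simps)

lemma conj_2:
  assumes "a \<in> carrier_vec 3" "b \<in> carrier_vec 3" "i < 3"
  shows "conj_fst 2 G a b $ i = G $$ (1,1) * subst_coeffs G a i - G $$ (0,1) * subst_coeffs G b i"
    and "conj_snd 2 G a b $ i = G $$ (0,0) * subst_coeffs G b i - G $$ (1,0) * subst_coeffs G a i"
proof -
  have "i = 0 \<or> i = Suc 0 \<or> i = 2" using assms(3) by auto
  then show "conj_fst 2 G a b $ i = G $$ (1,1) * subst_coeffs G a i - G $$ (0,1) * subst_coeffs G b i"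
    and "conj_snd 2 G a b $ i = G $$ (0,0) * subst_coeffs G b i - G $$ (1,0) * subst_coeffs G a i"
    unfolding conj_fst_def conj_snd_def form_coeffs_def
      form_subst_2[OF assms(1)] form_subst_2[OF assms(2)] cst_def
    by (auto simp: numeral_2_eq_2)
qed

section \<open>Transformation law of the resultant\<close>

definition mat_det2 :: "'a::comm_ring_1 mat \<Rightarrow> 'a" where
  "mat_det2 G = G $$ (0,0) * G $$ (1,1) - G $$ (0,1) * G $$ (1,0)"

text \<open>The resultant as a function of six scalars, so that substitution of variables and linear
  combination of the two forms become separate polynomial identities.\<close>

definition res22 :: "'a::comm_ring_1 \<Rightarrow> 'a \<Rightarrow> 'a \<Rightarrow> 'a \<Rightarrow> 'a \<Rightarrow> 'a \<Rightarrow> 'a" where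
  "res22 a0 a1 a2 b0 b1 b2 =
    (a0 * b2 - a2 * b0)\<^sup>2 - (a0 * b1 - a1 * b0) * (a1 * b2 - a2 * b1)"

text \<open>The Jacobian of the two forms is twice m01 X^2 + 2 m02 XY + m12 Y^2, and a Jacobian is a
  covariant of weight one: it is substituted into and multiplied by the determinant.\<close>

lemma minors_subst:
  fixes a0 a1 a2 b0 b1 b2 \<alpha> \<beta> \<gamma> \<delta> :: "'a::comm_ring_1"
  defines "m01 \<equiv> a0 * b1 - a1 * b0" and "m02 \<equiv> a0 * b2 - a2 * b0" and "m12 \<equiv> a1 * b2 - a2 * b1"
  defines "A0 \<equiv> a0 * \<alpha>\<^sup>2 + a1 * \<alpha> * \<gamma> + a2 * \<gamma>\<^sup>2"
    and "A1 \<equiv> 2 * a0 * \<alpha> * \<beta> + a1 * (\<alpha> * \<delta> + \<beta> * \<gamma>) + 2 * a2 * \<gamma> * \<delta>"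
    and "A2 \<equiv> a0 * \<beta>\<^sup>2 + a1 * \<beta> * \<delta> + a2 * \<delta>\<^sup>2"
    and "B0 \<equiv> b0 * \<alpha>\<^sup>2 + b1 * \<alpha> * \<gamma> + b2 * \<gamma>\<^sup>2"
    and "B1 \<equiv> 2 * b0 * \<alpha> * \<beta> + b1 * (\<alpha> * \<delta> + \<beta> * \<gamma>) + 2 * b2 * \<gamma> * \<delta>"
    and "B2 \<equiv> b0 * \<beta>\<^sup>2 + b1 * \<beta> * \<delta> + b2 * \<delta>\<^sup>2"
  shows "A0 * B1 - A1 * B0 = (\<alpha> * \<delta> - \<beta> * \<gamma>) * (\<alpha>\<^sup>2 * m01 + 2 * \<alpha> * \<gamma> * m02 + \<gamma>\<^sup>2 * m12)"
    and "A0 * B2 - A2 * B0 =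
      (\<alpha> * \<delta> - \<beta> * \<gamma>) * (\<alpha> * \<beta> * m01 + (\<alpha> * \<delta> + \<beta> * \<gamma>) * m02 + \<gamma> * \<delta> * m12)"
    and "A1 * B2 - A2 * B1 = (\<alpha> * \<delta> - \<beta> * \<gamma>) * (\<beta>\<^sup>2 * m01 + 2 * \<beta> * \<delta> * m02 + \<delta>\<^sup>2 * m12)"
  unfolding assms by (simp_all add: power2_eq_square algebra_simps)

text \<open>Four times the resultant is the discriminant of m01 X^2 + 2 m02 XY + m12 Y^2.
  Substitution multiplies a quadratic discriminant by the squared determinant, and the extra
  determinant on every minor contributes another square.\<close>

lemma res22_subst:
  fixes a0 a1 a2 b0 b1 b2 \<alpha> \<beta> \<gamma> \<delta> :: "'a::comm_ring_1"
  shows "res22 (a0 * \<alpha>\<^sup>2 + a1 * \<alpha> * \<gamma> + a2 * \<gamma>\<^sup>2)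
      (2 * a0 * \<alpha> * \<beta> + a1 * (\<alpha> * \<delta> + \<beta> * \<gamma>) + 2 * a2 * \<gamma> * \<delta>)
      (a0 * \<beta>\<^sup>2 + a1 * \<beta> * \<delta> + a2 * \<delta>\<^sup>2)
      (b0 * \<alpha>\<^sup>2 + b1 * \<alpha> * \<gamma> + b2 * \<gamma>\<^sup>2)
      (2 * b0 * \<alpha> * \<beta> + b1 * (\<alpha> * \<delta> + \<beta> * \<gamma>) + 2 * b2 * \<gamma> * \<delta>)
      (b0 * \<beta>\<^sup>2 + b1 * \<beta> * \<delta> + b2 * \<delta>\<^sup>2)
    = (\<alpha> * \<delta> - \<beta> * \<gamma>) ^ 4 * res22 a0 a1 a2 b0 b1 b2"
proof -
  \<comment> \<open>The outer factor \<open>D\<close> stays a free variable, which keeps the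
    identity to be expanded at low degree.\<close>
  have quad: "(D * (\<alpha> * \<beta> * m01 + (\<alpha> * \<delta> + \<beta> * \<gamma>) * m02 + \<gamma> * \<delta> * m12))\<^sup>2
      - D * (\<alpha>\<^sup>2 * m01 + 2 * \<alpha> * \<gamma> * m02 + \<gamma>\<^sup>2 * m12)
        * (D * (\<beta>\<^sup>2 * m01 + 2 * \<beta> * \<delta> * m02 + \<delta>\<^sup>2 * m12))
    = D\<^sup>2 * (\<alpha> * \<delta> - \<beta> * \<gamma>)\<^sup>2 * (m02\<^sup>2 - m01 * m12)" for D m01 m02 m12 :: 'a
    by (simp add: power2_eq_square algebra_simps)
  show ?thesis
    unfolding res22_def minors_subst quad by (simp flip: power_add)
qed

text \<open>Each minor is multiplied by the determinant of the linear combination, and the resultant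
  is quadratic in the minors.\<close>

lemma res22_lincomb:
  fixes a0 a1 a2 b0 b1 b2 \<alpha> \<beta> \<gamma> \<delta> :: "'a::comm_ring_1"
  shows "res22 (\<delta> * a0 - \<beta> * b0) (\<delta> * a1 - \<beta> * b1) (\<delta> * a2 - \<beta> * b2)
      (\<alpha> * b0 - \<gamma> * a0) (\<alpha> * b1 - \<gamma> * a1) (\<alpha> * b2 - \<gamma> * a2)
    = (\<alpha> * \<delta> - \<beta> * \<gamma>)\<^sup>2 * res22 a0 a1 a2 b0 b1 b2"
proof -
  have minor: "(\<delta> * u - \<beta> * v) * (\<alpha> * y - \<gamma> * x) - (\<delta> * x - \<beta> * y) * (\<alpha> * v - \<gamma> * u) =
      (\<alpha> * \<delta> - \<beta> * \<gamma>) * (u * y - x * v)" for u v x y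
    by (simp add: power2_eq_square algebra_simps)
  have "(D * x)\<^sup>2 - D * y * (D * z) = D\<^sup>2 * (x\<^sup>2 - y * z)" for D x y z :: 'a
    by (simp add: power2_eq_square algebra_simps)
  then show ?thesis unfolding res22_def minor .
qed

text \<open>The exponent 6 is 4 from substituting variables plus 2 from applying the adjugate to the
  pair of forms.\<close>

lemma form_resultant_conj_2:
  assumes "a \<in> carrier_vec 3" "b \<in> carrier_vec 3"
  shows "form_resultant 2 (conj_fst 2 G a b) (conj_snd 2 G a b) = mat_det2 G ^ 6 * form_resultant 2 a b"
proof -
  have res: "form_resultant 2 u v = res22 (u $ 0) (u $ 1) (u $ 2) (v $ 0) (v $ 1) (v $ 2)"
    for u v :: "'a vec"
    by (simp add: form_resultant_2 res22_def)
  have "form_resultant 2 (conj_fst 2 G a b) (conj_snd 2 G a b) =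
    mat_det2 G ^ 2 * res22 (subst_coeffs G a 0) (subst_coeffs G a 1) (subst_coeffs G a 2)
      (subst_coeffs G b 0) (subst_coeffs G b 1) (subst_coeffs G b 2)"
    unfolding res mat_det2_def res22_lincomb[symmetric] using assms by (simp add: conj_2)
  also have "\<dots> = mat_det2 G ^ 2 * (mat_det2 G ^ 4 * form_resultant 2 a b)"
    unfolding res mat_det2_def res22_subst[symmetric] by (simp add: subst_coeffs_def Let_def)
  also have "mat_det2 G ^ 2 * (mat_det2 G ^ 4 * x) = mat_det2 G ^ 6 * x" for x
    by (simp add: mult.assoc[symmetric] flip: power_add)
  finally show ?thesis .
qed

text \<open>
  The discriminant of the Hessian of \<open>p X\<^sup>3 + q X\<^sup>2 Y + r X Y\<^sup>2 + s Y\<^sup>3\<close>, that is \<open>- 3\<close> times the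
  discriminant of the cubic. Its transformation law follows from that of the Hessian by
  polynomial identities of low degree.
\<close>

definition hessian_disc :: "'a::comm_ring_1 \<Rightarrow> 'a \<Rightarrow> 'a \<Rightarrow> 'a \<Rightarrow> 'a" where
  "hessian_disc p q r s = (q * r - 9 * p * s)\<^sup>2 - 4 * (q\<^sup>2 - 3 * p * r) * (r\<^sup>2 - 3 * q * s)"

lemma hessian_disc_subst:
  fixes p q r s \<alpha> \<beta> \<gamma> \<delta> :: "'a::comm_ring_1"
  defines "p' \<equiv> p * \<alpha> ^ 3 + q * \<alpha>\<^sup>2 * \<gamma> + r * \<alpha> * \<gamma>\<^sup>2 + s * \<gamma> ^ 3"
    and "q' \<equiv> 3 * p * \<alpha>\<^sup>2 * \<beta> + q * (\<alpha>\<^sup>2 * \<delta> + 2 * \<alpha> * \<beta> * \<gamma>)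
      + r * (2 * \<alpha> * \<gamma> * \<delta> + \<beta> * \<gamma>\<^sup>2) + 3 * s * \<gamma>\<^sup>2 * \<delta>"
    and "r' \<equiv> 3 * p * \<alpha> * \<beta>\<^sup>2 + q * (2 * \<alpha> * \<beta> * \<delta> + \<beta>\<^sup>2 * \<gamma>)
      + r * (\<alpha> * \<delta>\<^sup>2 + 2 * \<beta> * \<gamma> * \<delta>) + 3 * s * \<gamma> * \<delta>\<^sup>2"
    and "s' \<equiv> p * \<beta> ^ 3 + q * \<beta>\<^sup>2 * \<delta> + r * \<beta> * \<delta>\<^sup>2 + s * \<delta> ^ 3"
  shows "hessian_disc p' q' r' s' = (\<alpha> * \<delta> - \<beta> * \<gamma>) ^ 6 * hessian_disc p q r s"
proof -
  define D where "D = \<alpha> * \<delta> - \<beta> * \<gamma>"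
  \<comment> \<open>Up to a scalar the Hessian of the cubic is h0 X^2 + h1 XY + h2 Y^2, a covariant
    of weight two; hence the factor \<open>D\<close> squared in the next three identities.\<close>
  define h0 h1 h2 where h: "h0 = q\<^sup>2 - 3 * p * r" "h1 = q * r - 9 * p * s" "h2 = r\<^sup>2 - 3 * q * s"
  have "q'\<^sup>2 - 3 * p' * r' = D\<^sup>2 * (h0 * \<alpha>\<^sup>2 + h1 * \<alpha> * \<gamma> + h2 * \<gamma>\<^sup>2)"
    unfolding assms h D_def by (simp add: power2_eq_square power3_eq_cube algebra_simps)
  moreover have "r'\<^sup>2 - 3 * q' * s' = D\<^sup>2 * (h0 * \<beta>\<^sup>2 + h1 * \<beta> * \<delta> + h2 * \<delta>\<^sup>2)"
    unfolding assms h D_def by (simp add: power2_eq_square power3_eq_cube algebra_simps)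
  moreover have "q' * r' - 9 * p' * s' =
      D\<^sup>2 * (2 * h0 * \<alpha> * \<beta> + h1 * (\<alpha> * \<delta> + \<beta> * \<gamma>) + 2 * h2 * \<gamma> * \<delta>)"
    unfolding assms h D_def by (simp add: power2_eq_square power3_eq_cube algebra_simps)
  \<comment> \<open>The law for the discriminant of a quadratic form, applied to the Hessian;
    \<open>D\<close> is left folded here.\<close>
  moreover have "(D\<^sup>2 * (2 * h0 * \<alpha> * \<beta> + h1 * (\<alpha> * \<delta> + \<beta> * \<gamma>) + 2 * h2 * \<gamma> * \<delta>))\<^sup>2
     - 4 * (D\<^sup>2 * (h0 * \<alpha>\<^sup>2 + h1 * \<alpha> * \<gamma> + h2 * \<gamma>\<^sup>2)) * (D\<^sup>2 * (h0 * \<beta>\<^sup>2 + h1 * \<beta> * \<delta> + h2 * \<delta>\<^sup>2))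
    = D ^ 4 * (\<alpha> * \<delta> - \<beta> * \<gamma>)\<^sup>2 * (h1\<^sup>2 - 4 * h0 * h2)"
    by (simp add: power2_eq_square power4_eq_xxxx algebra_simps)
  ultimately have "hessian_disc p' q' r' s' = D ^ 4 * D\<^sup>2 * hessian_disc p q r s"
    unfolding hessian_disc_def by (simp only: h D_def)
  also have "D ^ 4 * D\<^sup>2 = D ^ 6"
    by (simp flip: power_add)
  finally show ?thesis unfolding D_def .
qed

text \<open>
  The fixed points of \<open>[F\<^sub>a : F\<^sub>b]\<close> are the zeros of the cubic form \<open>Y F\<^sub>a - X F\<^sub>b\<close>, on which
  conjugation by \<open>\<Gamma>\<close> acts by plain substitution, without any factor \<open>det \<Gamma>\<close>.
\<close>

definition fix_disc :: "'a::comm_ring_1 vec \<Rightarrow> 'a vec \<Rightarrow> 'a" where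
  "fix_disc a b = hessian_disc (- (b $ 0)) (a $ 0 - b $ 1) (a $ 1 - b $ 2) (a $ 2)"

lemma fix_disc_conj:
  assumes "a \<in> carrier_vec 3" "b \<in> carrier_vec 3"
  shows "fix_disc (conj_fst 2 G a b) (conj_snd 2 G a b) = mat_det2 G ^ 6 * fix_disc a b"
proof -
  let ?A = "conj_fst 2 G a b" and ?B = "conj_snd 2 G a b"
  define p q r s where P: "p = - (b $ 0)" "q = a $ 0 - b $ 1" "r = a $ 1 - b $ 2" "s = a $ 2"
  define \<alpha> \<beta> \<gamma> \<delta> where G: "\<alpha> = G $$ (0,0)" "\<beta> = G $$ (0,1)" "\<gamma> = G $$ (1,0)" "\<delta> = G $$ (1,1)"
  note conj = conj_2[OF assms] subst_coeffs_def Let_def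
  \<comment> \<open>The adjugate in the conjugation cancels: Y (\<delta> F - \<beta> G) - X
    (\<alpha> G - \<gamma> F) = (\<gamma> X + \<delta> Y) F - (\<alpha> X + \<beta> Y) G. The four
    equations compare coefficients of this cubic.\<close>
  have "- (?B $ 0) = p * \<alpha> ^ 3 + q * \<alpha>\<^sup>2 * \<gamma> + r * \<alpha> * \<gamma>\<^sup>2 + s * \<gamma> ^ 3"
    by (simp add: conj P flip: G[simplified]) (simp add: power2_eq_square power3_eq_cube algebra_simps)
  moreover have "?A $ 0 - ?B $ 1 = 3 * p * \<alpha>\<^sup>2 * \<beta> + q * (\<alpha>\<^sup>2 * \<delta> + 2 * \<alpha> * \<beta> * \<gamma>)
      + r * (2 * \<alpha> * \<gamma> * \<delta> + \<beta> * \<gamma>\<^sup>2) + 3 * s * \<gamma>\<^sup>2 * \<delta>"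
    by (simp add: conj P flip: G[simplified]) (simp add: power2_eq_square power3_eq_cube algebra_simps)
  moreover have "?A $ 1 - ?B $ 2 = 3 * p * \<alpha> * \<beta>\<^sup>2 + q * (2 * \<alpha> * \<beta> * \<delta> + \<beta>\<^sup>2 * \<gamma>)
      + r * (\<alpha> * \<delta>\<^sup>2 + 2 * \<beta> * \<gamma> * \<delta>) + 3 * s * \<gamma> * \<delta>\<^sup>2"
    by (simp add: conj P flip: G[simplified]) (simp add: power2_eq_square power3_eq_cube algebra_simps)
  moreover have "?A $ 2 = p * \<beta> ^ 3 + q * \<beta>\<^sup>2 * \<delta> + r * \<beta> * \<delta>\<^sup>2 + s * \<delta> ^ 3"
    by (simp add: conj P flip: G[simplified]) (simp add: power2_eq_square power3_eq_cube algebra_simps)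
  ultimately show ?thesis
    unfolding fix_disc_def mat_det2_def G[symmetric] P[symmetric] by (simp only: hessian_disc_subst)
qed

section \<open>Valuations\<close>

lemma poly_val_add:
  assumes "f \<noteq> 0" "g \<noteq> 0" "f + g \<noteq> 0"
  shows "min (poly_val p f) (poly_val p g) \<le> poly_val p (f + g)"
proof (cases p)
  case (Finite c)
  let ?n = "min (Polynomial.order c f) (Polynomial.order c g)"
  have "[:- c, 1:] ^ ?n dvd f + g"
    using assms by (intro dvd_add) (simp_all add: order_divides)
  then show ?thesis
    using assms Finite by (simp add: order_divides min_def split: if_splits)
next
  case Infinity
  then show ?thesis
    using Polynomial.degree_add_le_max[of f g] by (auto simp: min_def max_def split: if_splits)
qed

lemma fract_nonzero_cases:
  fixes x :: "'a::idom fract"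
  assumes "x \<noteq> 0"
  obtains f g where "x = Fraction_Field.Fract f g" "f \<noteq> 0" "g \<noteq> 0"
  using assms by (cases x rule: Fract_cases_nonzero) auto

lemma val_mult:
  assumes "x \<noteq> 0" "y \<noteq> 0"
  shows "val p (x * y) = val p x + val p y"
proof -
  obtain f g where x: "x = Fraction_Field.Fract f g" "f \<noteq> 0" "g \<noteq> 0"
    using assms(1) by (rule fract_nonzero_cases)
  obtain f' g' where y: "y = Fraction_Field.Fract f' g'" "f' \<noteq> 0" "g' \<noteq> 0"
    using assms(2) by (rule fract_nonzero_cases)
  show ?thesis using x y by (simp add: val_Fract poly_val_mult)
qed

lemma val_1 [simp]: "val p 1 = 0"
proof -
  have "val p (1 * 1) = val p 1 + val p 1" by (rule val_mult) simp_all
  then show ?thesis by simp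
qed

lemma val_power: "x \<noteq> 0 \<Longrightarrow> val p (x ^ n) = int n * val p x"
  by (induction n) (simp_all add: val_mult algebra_simps)

lemma val_uminus [simp]: "val p (- x) = val p x"
proof (cases "x = 0")
  case False
  have "val p ((- 1) * (- 1)) = val p (- 1) + val p (- 1)" by (rule val_mult) simp_all
  then have "val p (- 1) = 0" by simp
  then show ?thesis using val_mult[of "- 1" x p] False by simp
qed simp

lemma val_add:
  assumes "x \<noteq> 0" "y \<noteq> 0" "x + y \<noteq> 0"
  shows "min (val p x) (val p y) \<le> val p (x + y)"
proof -
  obtain f g where x: "x = Fraction_Field.Fract f g" "f \<noteq> 0" "g \<noteq> 0"
    using assms(1) by (rule fract_nonzero_cases)
  obtain f' g' where y: "y = Fraction_Field.Fract f' g'" "f' \<noteq> 0" "g' \<noteq> 0"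
    using assms(2) by (rule fract_nonzero_cases)
  have xy: "x + y = Fraction_Field.Fract (f * g' + f' * g) (g * g')"
    using x y by simp
  then have nz: "f * g' + f' * g \<noteq> 0"
    using assms(3) by (auto simp: Fraction_Field.fract_collapse)
  have "min (poly_val p (f * g')) (poly_val p (f' * g)) \<le> poly_val p (f * g' + f' * g)"
    using x y nz by (intro poly_val_add) auto
  then show ?thesis
    unfolding xy using x y nz by (simp add: val_Fract poly_val_mult)
qed

text \<open>Zero satisfies every bound, as valuation +infinity should, although
  \<open>val p 0\<close> is the dummy 0. Sums and products then need no nonvanishing
  conditions.\<close>

definition val_ge :: "'k::field pline \<Rightarrow> int \<Rightarrow> 'k poly fract \<Rightarrow> bool" where
  "val_ge p m x \<longleftrightarrow> x = 0 \<or> m \<le> val p x"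

lemma val_ge_add: "val_ge p m x \<Longrightarrow> val_ge p m y \<Longrightarrow> val_ge p m (x + y)"
  unfolding val_ge_def using val_add[of x y p] by fastforce

lemma val_ge_uminus: "val_ge p m x \<Longrightarrow> val_ge p m (- x)"
  by (simp add: val_ge_def)

lemma val_ge_diff: "val_ge p m x \<Longrightarrow> val_ge p m y \<Longrightarrow> val_ge p m (x - y)"
  using val_ge_add[of p m x "- y"] val_ge_uminus[of p m y] by simp

lemma val_ge_mult: "val_ge p m x \<Longrightarrow> val_ge p n y \<Longrightarrow> val_ge p (m + n) (x * y)"
  unfolding val_ge_def using val_mult[of x y p] by fastforce

lemma val_ge_numeral: "val_ge p 0 (numeral k)"
proof -
  have "val_ge p 0 (of_nat n)" for n
    by (induction n) (auto intro!: val_ge_add simp: val_ge_def[of _ _ 1] val_ge_def[of _ _ 0])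
  from this[of "numeral k"] show ?thesis by simp
qed

lemma val_ge_scale: "val_ge p m x \<Longrightarrow> val_ge p m (numeral k * x)"
  using val_ge_mult[OF val_ge_numeral] by fastforce

text \<open>The minimum runs over nonzero coordinates only; the zero ones are absorbed by
  \<open>val_ge\<close>.\<close>

lemma val_ge_coord:
  assumes "a \<in> carrier_vec n" "b \<in> carrier_vec n" "i < n"
  shows "val_ge p (coord_min_val p a b) (a $ i)" "val_ge p (coord_min_val p a b) (b $ i)"
proof -
  have fin: "finite (val p ` ((set\<^sub>v a \<union> set\<^sub>v b) - {0}))"
    by (simp add: vec_set_def)
  have "a $ i \<in> set\<^sub>v a" "b $ i \<in> set\<^sub>v b"
    using assms by (auto intro: vec_setI)
  then show "val_ge p (coord_min_val p a b) (a $ i)" "val_ge p (coord_min_val p a b) (b $ i)"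
    unfolding val_ge_def coord_min_val_def using fin by (auto intro!: Min_le)
qed

text \<open>The resultant is homogeneous of degree 4 in the coordinates.\<close>

lemma val_ge_form_resultant_2:
  assumes "a \<in> carrier_vec 3" "b \<in> carrier_vec 3"
  shows "val_ge p (4 * coord_min_val p a b) (form_resultant 2 a b)"
proof -
  define n where "n = coord_min_val p a b"
  have c: "val_ge p n (a $ i)" "val_ge p n (b $ i)" if "i < 3" for i
    using val_ge_coord[OF assms that] by (simp_all add: n_def)
  have "val_ge p ((n + n) + (n + n)) (form_resultant 2 a b)"
    unfolding form_resultant_2 power2_eq_square
    by (intro val_ge_diff val_ge_mult c) simp_all
  then show ?thesis by (simp add: n_def)
qed

lemma val_ge_fix_disc:
  assumes "a \<in> carrier_vec 3" "b \<in> carrier_vec 3"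
  shows "val_ge p (4 * coord_min_val p a b) (fix_disc a b)"
proof -
  define n where "n = coord_min_val p a b"
  have c: "val_ge p n (a $ i)" "val_ge p n (b $ i)" if "i < 3" for i
    using val_ge_coord[OF assms that] by (simp_all add: n_def)
  have "val_ge p ((n + n) + (n + n)) (fix_disc a b)"
    \<comment> \<open>Reassociation moves the numerals to the front, where
      \<open>val_ge_scale\<close> discards them; each remaining product has four coordinate
      factors.\<close>
    unfolding fix_disc_def hessian_disc_def power2_eq_square mult.assoc[of "numeral _"]
    by (intro val_ge_diff val_ge_scale val_ge_mult val_ge_uminus c) simp_all
  then show ?thesis by (simp add: n_def)
qed

lemma conj_carrier [simp]: "conj_fst d G a b \<in> carrier_vec (d + 1)" "conj_snd d G a b \<in> carrier_vec (d + 1)"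
  by (simp_all add: conj_fst_def conj_snd_def form_coeffs_def)

lemma conj_carrier_3: "conj_fst 2 G a b \<in> carrier_vec 3" "conj_snd 2 G a b \<in> carrier_vec 3"
  using conj_carrier[of 2 G a b] by simp_all

lemma mat_det2_GL2: "G \<in> GL2 \<Longrightarrow> mat_det2 G \<noteq> 0"
proof -
  assume "G \<in> GL2"
  then have G: "G \<in> carrier_mat 2 2" and "invertible_mat G"
    by (auto simp: GL2_def)
  then obtain B where B: "G * B = 1\<^sub>m 2" "B * G = 1\<^sub>m (dim_row B)"
    unfolding invertible_mat_def inverts_mat_def by auto
  have "B \<in> carrier_mat 2 2"
    using G B by (metis carrier_matD(2) carrier_matI index_mult_mat(3) index_one_mat(3))
  then have "Determinant.det G * Determinant.det B = 1"
    using B(1) det_mult[OF G, of B] by simp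
  \<comment> \<open>Written as an explicit \<open>mat\<close>, \<open>G\<close> can be expanded by
    \<open>det_mat_Suc\<close>.\<close>
  moreover have "G = mat (Suc (Suc 0)) (Suc (Suc 0)) (\<lambda>ij. G $$ ij)"
    using G by (intro eq_matI) auto
  then have "Determinant.det G = mat_det2 G"
    by (subst \<open>G = _\<close>, unfold det_mat_Suc) (simp add: det_mat_0 lessThan_Suc mat_det2_def)
  ultimately show ?thesis by auto
qed

section \<open>Bounds for the minimal resultant\<close>

lemma one_mat_GL2: "1\<^sub>m 2 \<in> GL2"
  by (auto simp: GL2_def invertible_mat_def inverts_mat_def intro!: exI[of _ "1\<^sub>m 2"])

lemma conj_one:
  assumes "a \<in> carrier_vec 3" "b \<in> carrier_vec 3"
  shows "conj_fst 2 (1\<^sub>m 2) a b = a" "conj_snd 2 (1\<^sub>m 2) a b = b"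
proof -
  have three: "i = 0 \<or> i = Suc 0 \<or> i = 2" if "i < 3" for i :: nat using that by auto
  show "conj_fst 2 (1\<^sub>m 2) a b = a" "conj_snd 2 (1\<^sub>m 2) a b = b"
    using assms conj_carrier_3[of "1\<^sub>m 2" a b]
    by (auto simp: conj_2 subst_coeffs_def dest!: three intro!: Matrix.eq_vecI)
qed

text \<open>The integers are not well-ordered, so \<open>LEAST\<close> needs the lower bound
  \<open>L\<close>; shifting by \<open>L\<close> reduces to the natural numbers.\<close>

lemma int_Least:
  fixes P :: "int \<Rightarrow> bool"
  assumes "P m" "\<And>m. P m \<Longrightarrow> L \<le> m"
  shows "P (LEAST m. P m)" "(LEAST m. P m) \<le> m"
proof -
  define n where "n = (LEAST n. P (L + int n))"
  have "P (L + int (nat (m - L)))" using assms by simp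
  then have "P (L + int n)" unfolding n_def by (rule LeastI)
  moreover have "L + int n \<le> k" if "P k" for k
  proof -
    have "P (L + int (nat (k - L)))" using assms(2) that by simp
    then have "n \<le> nat (k - L)" unfolding n_def by (rule Least_le)
    then show ?thesis using assms(2)[OF that] by linarith
  qed
  ultimately have "(LEAST m. P m) = L + int n" by (rule Least_equality)
  then show "P (LEAST m. P m)" "(LEAST m. P m) \<le> m"
    using \<open>P (L + int n)\<close> \<open>\<And>k. P k \<Longrightarrow> L + int n \<le> k\<close> assms(1) by simp_all
qed

text \<open>For d = 2 the subtracted term is 4 times the coordinate minimum, exactly what
  homogeneity bounds. This also supplies the lower bound under which the minimum over conjugates
  exists.\<close>

lemma res_val_conj_nonneg:
  assumes "a \<in> carrier_vec 3" "b \<in> carrier_vec 3" "form_resultant 2 a b \<noteq> 0" "G \<in> GL2"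
  shows "0 \<le> res_val 2 p (conj_fst 2 G a b) (conj_snd 2 G a b)"
  using val_ge_form_resultant_2[OF conj_carrier_3, of p G a b G a b] mat_det2_GL2[OF assms(4)] assms
  by (simp add: res_val_def val_ge_def form_resultant_conj_2)

text \<open>Both invariants acquire \<open>mat_det2 G ^ 6\<close>, so its valuation cancels and the
  bound no longer depends on \<open>G\<close>.\<close>

lemma res_val_conj_lower:
  assumes "a \<in> carrier_vec 3" "b \<in> carrier_vec 3" "form_resultant 2 a b \<noteq> 0" "G \<in> GL2"
    and "fix_disc a b \<noteq> 0"
  shows "val p (form_resultant 2 a b) - val p (fix_disc a b)
    \<le> res_val 2 p (conj_fst 2 G a b) (conj_snd 2 G a b)"
  using val_ge_fix_disc[OF conj_carrier_3, of p G a b G a b] mat_det2_GL2[OF assms(4)] assms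
  by (simp add: res_val_def val_ge_def form_resultant_conj_2 fix_disc_conj val_mult)

lemma min_resultant_attained:
  assumes "a \<in> carrier_vec 3" "b \<in> carrier_vec 3" "form_resultant 2 a b \<noteq> 0"
  obtains G where "G \<in> GL2"
    "min_resultant 2 a b p = res_val 2 p (conj_fst 2 G a b) (conj_snd 2 G a b)"
proof -
  have "\<exists>G\<in>GL2. min_resultant 2 a b p = res_val 2 p (conj_fst 2 G a b) (conj_snd 2 G a b)"
    unfolding min_resultant_def
    by (rule int_Least(1)[where L = 0]) (use one_mat_GL2 res_val_conj_nonneg[OF assms] in blast)+
  then show ?thesis using that by blast
qed

text \<open>The identity matrix is one of the competitors.\<close>

lemma min_resultant_le_res_val:
  assumes "a \<in> carrier_vec 3" "b \<in> carrier_vec 3" "form_resultant 2 a b \<noteq> 0"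
  shows "min_resultant 2 a b p \<le> res_val 2 p a b"
  unfolding min_resultant_def
  by (rule int_Least(2)[where L = 0])
    (use one_mat_GL2 conj_one[OF assms(1,2)] res_val_conj_nonneg[OF assms] in force)+

lemma min_resultant_nonneg:
  assumes "a \<in> carrier_vec 3" "b \<in> carrier_vec 3" "form_resultant 2 a b \<noteq> 0"
  shows "0 \<le> min_resultant 2 a b p"
  by (rule min_resultant_attained[OF assms, of p]) (simp add: res_val_conj_nonneg assms)

lemma min_resultant_lower:
  assumes "a \<in> carrier_vec 3" "b \<in> carrier_vec 3" "form_resultant 2 a b \<noteq> 0" "fix_disc a b \<noteq> 0"
  shows "val p (form_resultant 2 a b) - val p (fix_disc a b) \<le> min_resultant 2 a b p"
  by (rule min_resultant_attained[OF assms(1-3), of p]) (simp add: res_val_conj_lower assms)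

section \<open>Polynomials in t as elements of the function field\<close>

lemma val_to_fract: "f \<noteq> 0 \<Longrightarrow> val p (to_fract f) = poly_val p f"
  by (cases p) (simp_all add: to_fract_def val_Fract)

lemma val_to_fract_Finite_eq_0:
  assumes "poly f c \<noteq> 0"
  shows "val (Finite c) (to_fract f) = 0"
proof -
  have "f \<noteq> 0" using assms by auto
  then show ?thesis using assms by (simp add: val_to_fract order_0I)
qed

lemma kconst_to_fract: "kconst c = to_fract [:c:]"
  by (simp add: kconst_def to_fract_def)

lemma tvar_to_fract: "tvar = to_fract [:0, 1:]"
  by (simp add: tvar_def to_fract_def)

lemma to_fract_power [simp]: "to_fract (f ^ n) = to_fract f ^ n"
  by (induction n) simp_all

lemma to_fract_numeral [simp]: "to_fract (numeral k) = numeral k"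
proof -
  have "to_fract (of_nat n) = of_nat n" for n
    by (induction n) simp_all
  from this[of "numeral k"] show ?thesis by simp
qed

text \<open>Polynomials have no poles at finite points. A nonzero coordinate is required because
  \<open>Min\<close> of the empty set is unspecified.\<close>

lemma coord_min_val_Finite_nonneg:
  assumes "\<forall>x\<in>set\<^sub>v a \<union> set\<^sub>v b. \<exists>f. x = to_fract f" "\<exists>x\<in>set\<^sub>v a \<union> set\<^sub>v b. x \<noteq> 0"
  shows "0 \<le> coord_min_val (Finite c) a b"
proof -
  have "finite (val (Finite c) ` ((set\<^sub>v a \<union> set\<^sub>v b) - {0}))"
    by (simp add: vec_set_def)
  moreover have "0 \<le> val (Finite c) x" if x: "x \<in> (set\<^sub>v a \<union> set\<^sub>v b) - {0}" for x
  proof -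
    obtain f where f: "x = to_fract f" using assms(1) x by (metis DiffD1)
    then have "f \<noteq> 0" using x by auto
    then show ?thesis by (simp add: f val_to_fract)
  qed
  moreover have "(set\<^sub>v a \<union> set\<^sub>v b) - {0} \<noteq> {}"
    using assms(2) by (metis DiffI empty_iff singletonD)
  ultimately show ?thesis
    unfolding coord_min_val_def by (subst Min_ge_iff) (simp_all only: image_is_empty ball_simps, simp_all)
qed

section \<open>The family of quadratic maps\<close>

text \<open>If one coordinate of a common zero vanishes, the unit coefficients of X^2 and Y^2 force
  the other to vanish. Otherwise cancelling u and v leaves a linear system of determinant 1 -
  xy.\<close>

lemma is_presentation_2:
  fixes x y :: "'a::field"
  assumes "x * y \<noteq> 1"
  shows "is_presentation 2 (vec_of_list [1, x, 0]) (vec_of_list [0, y, 1])"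
proof -
  have "u = 0 \<and> v = 0"
    if F: "form 2 (map_vec to_ac (vec_of_list [1, x, 0])) u v = 0"
      and G: "form 2 (map_vec to_ac (vec_of_list [0, y, 1])) u v = 0" for u v
  proof -
    have e: "u\<^sup>2 + to_ac x * u * v = 0" "to_ac y * u * v + v\<^sup>2 = 0"
      using F G unfolding form_2 by (simp_all add: numeral_2_eq_2)
    have "to_ac (x * y) \<noteq> 1" using assms to_ac_eq_1_iff[of "x * y"] by metis
    show ?thesis
    proof (cases "u = 0 \<or> v = 0")
      case True
      then show ?thesis using e by auto
    next
      case False
      have "u * (u + to_ac x * v) = 0" "v * (to_ac y * u + v) = 0"
        using e by (simp_all add: power2_eq_square distrib_left mult_ac)
      then have "u + to_ac x * v = 0" "to_ac y * u + v = 0"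
        using False by auto
      moreover have "u * (1 - to_ac (x * y)) = (u + to_ac x * v) - to_ac x * (to_ac y * u + v)"
        by (simp add: algebra_simps)
      ultimately have "u * (1 - to_ac (x * y)) = 0" by simp
      then show ?thesis using False \<open>to_ac (x * y) \<noteq> 1\<close> by simp
    qed
  qed
  then have "\<not> (\<exists>u v. (u, v) \<noteq> (0, 0) \<and>
      form 2 (map_vec to_ac (vec_of_list [1, x, 0])) u v = 0 \<and>
      form 2 (map_vec to_ac (vec_of_list [0, y, 1])) u v = 0)"
    by blast
  moreover have "vec_of_list [1, x, 0] \<in> carrier_vec (2 + 1)" "vec_of_list [0, y, 1] \<in> carrier_vec (2 + 1)"
    by (rule carrier_vecI; simp only: dim_vec_of_list list.size; simp)+
  ultimately show ?thesis
    unfolding is_presentation_def by (intro conjI)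
qed

theorem mainTheorem5:
  fixes a b b' :: "'k :: {alg_closed_field, field_char_0}"
    and N :: nat
    and l1 l2 :: "'k poly fract"
    and A B :: "'k poly fract vec"
  assumes "a \<noteq> 0" "a \<noteq> 1" "b \<noteq> 0" "b \<noteq> 1" "b' \<noteq> 0" "b' \<noteq> 1"
    and "a * b' + b / a = 0"
    and "N > 0"
    and "l1 = kconst a + kconst b * tvar ^ N"
    and "l2 = kconst (inverse a) + kconst b' * tvar ^ N"
    and "A = vec_of_list [1, l1, 0]"
    and "B = vec_of_list [0, l2, 1]"
  shows "is_presentation 2 A B \<and>
    is_divisor (min_resultant 2 A B) \<and> is_divisor (conductor 2 A B) \<and>
    divisor_degree (conductor 2 A B) \<le> 2 \<and>
    divisor_degree (min_resultant 2 A B) \<ge> 2 * int N"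
proof -
  define P Q where "P = [:a:] + [:b:] * [:0, 1:] ^ N" "Q = [:inverse a:] + [:b':] * [:0, 1:] ^ N"
  have l: "l1 = to_fract P" "l2 = to_fract Q"
    by (simp_all only: assms(9,10) P_Q_def kconst_to_fract tvar_to_fract to_fract_add
        to_fract_mult to_fract_power)
  let ?R = "min_resultant 2 A B"
  have carrier: "A \<in> carrier_vec 3" "B \<in> carrier_vec 3"
    unfolding assms(11,12) by (rule carrier_vecI; simp only: dim_vec_of_list list.size; simp)+
  have coord: "A $ 0 = 1" "A $ 1 = l1" "A $ 2 = 0" "B $ 0 = 0" "B $ 1 = l2" "B $ 2 = 1"
    by (simp_all add: assms(11,12) numeral_2_eq_2)
  define R where "R = [:- (b * b'):] * [:0, 1:] ^ (2 * N)"
  \<comment> \<open>The constant term cancels since \<open>a\<close> times its inverse is 1, and the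
    t^N term by \<open>a * b' + b / a = 0\<close>. It suffices to compare values at all points of
    the infinite field.\<close>
  have "1 - P * Q = R"
  proof (rule poly_ext)
    fix c
    have "poly (1 - P * Q) c = - (a * b' + b / a) * c ^ N + poly R c"
      using assms(1) by (simp add: P_Q_def R_def field_simps power_mult power2_eq_square)
    then show "poly (1 - P * Q) c = poly R c" using assms(7) by simp
  qed
  then have l12: "1 - l1 * l2 = to_fract R"
    by (simp add: l flip: to_fract_mult to_fract_1 to_fract_diff)
  have res: "form_resultant 2 A B = to_fract R"
    unfolding l12[symmetric] form_resultant_2 coord by simp
  have "R \<noteq> 0" using assms(3,5) by (simp add: R_def)
  then have res_nz: "form_resultant 2 A B \<noteq> 0" by (simp add: res)
  have "l1 * l2 \<noteq> 1"
    using \<open>R \<noteq> 0\<close> l12 by auto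
  then have pres: "is_presentation 2 A B"
    unfolding assms(11,12) by (rule is_presentation_2)
  \<comment> \<open>The fixed-point cubic is XY ((1 - Q) X + (P - 1) Y), with vanishing outer
    coefficients, so \<open>hessian_disc\<close> reduces to q^2 r^2 - 4 q^2 r^2.\<close>
  define D where "D = - (3 * ((1 - Q) * (P - 1))\<^sup>2)"
  have disc: "fix_disc A B = to_fract D"
    unfolding fix_disc_def hessian_disc_def coord D_def l
    by (simp add: power_mult_distrib)
  have "poly D 0 = - 3 * ((1 - inverse a) * (a - 1))\<^sup>2"
    using assms(8) by (simp add: D_def P_Q_def zero_power)
  \<comment> \<open>Here 3 is nonzero by characteristic 0, and both other factors are nonzero
    because \<open>a\<close> is not 1.\<close>
  then have D0: "poly D 0 \<noteq> 0"
    using assms(1,2) by simp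
  then have "fix_disc A B \<noteq> 0" using disc by auto
  have "val (Finite 0) (fix_disc A B) = 0"
    using D0 by (simp add: disc val_to_fract_Finite_eq_0)
  moreover have "val (Finite 0) (form_resultant 2 A B) = 2 * int N"
  proof -
    have "val (Finite 0) (to_fract [:0, 1 :: 'k:]) = 1"
      using order_power_n_n[of "0 :: 'k" 1] by (simp add: val_to_fract)
    moreover have "to_fract R = to_fract [:- (b * b'):] * to_fract [:0, 1:] ^ (2 * N)"
      by (simp only: R_def to_fract_mult to_fract_power)
    ultimately show ?thesis
      using assms(3,5) by (simp add: res val_mult val_power val_to_fract_Finite_eq_0)
  qed
  ultimately have R0: "2 * int N \<le> ?R (Finite 0)"
    using min_resultant_lower[OF carrier res_nz \<open>fix_disc A B \<noteq> 0\<close>, of "Finite 0"] by simp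
  have nonneg: "0 \<le> ?R p" for p
    by (rule min_resultant_nonneg[OF carrier res_nz])
  \<comment> \<open>The resultant is a unit at \<open>c\<close> and the coefficients are regular
    there, so the given representative already attains the lower bound 0.\<close>
  have "?R (Finite c) = 0" if "c \<noteq> 0" for c
  proof -
    have "poly R c \<noteq> 0" using that assms(3,5) by (simp add: R_def)
    moreover have "set\<^sub>v A \<union> set\<^sub>v B = {1, l1, 0, l2}"
      by (auto simp: assms(11,12) vec_set_def lessThan_Suc)
    then have "0 \<le> coord_min_val (Finite c) A B"
      by (intro coord_min_val_Finite_nonneg) (auto simp: l intro: exI[of _ 1])
    ultimately have "res_val 2 (Finite c) A B \<le> 0"
      by (simp add: res_val_def res val_to_fract_Finite_eq_0)
    then show ?thesis
      using min_resultant_le_res_val[OF carrier res_nz, of "Finite c"] nonneg[of "Finite c"] by simp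
  qed
  \<comment> \<open>Nothing is computed at \<open>Infinity\<close>; it is merely allowed in the
    support.\<close>
  then have supp: "Supp ?R \<subseteq> {Finite 0, Infinity}"
    by (auto simp: Supp_def) (metis pline.exhaust)
  then have fin: "finite (Supp ?R)" by (rule finite_subset) simp
  have supp_cond: "Supp (conductor 2 A B) = Supp ?R"
    by (auto simp: Supp_def conductor_def)
  have "divisor_degree (conductor 2 A B) = int (card (Supp ?R))"
    unfolding divisor_degree_def supp_cond by (simp add: conductor_def)
  also have "card (Supp ?R) \<le> card {Finite (0 :: 'k), Infinity}"
    using supp by (intro card_mono) simp_all
  finally have "divisor_degree (conductor 2 A B) \<le> 2" by simp
  moreover have "2 * int N \<le> divisor_degree ?R"
  proof -
    have "Finite 0 \<in> Supp ?R" using R0 assms(8) by (auto simp: Supp_def)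
    \<comment> \<open>All coefficients are nonnegative and the support is finite, so a single term
      bounds the sum from below.\<close>
    then have "?R (Finite 0) \<le> divisor_degree ?R"
      unfolding divisor_degree_def using fin nonneg by (intro member_le_sum) auto
    then show ?thesis using R0 by simp
  qed
  ultimately show ?thesis
    using pres fin by (simp add: is_divisor_def supp_cond)
qed

end
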